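(* Let $S$ be a finitely generated (right) $F_r$-set over the free group $F_r$ of rank $r>1$, with growth function $g(n)$ (with respect to a finite generating set). If the function $\dfrac{(2r-1)^n}{g(n)}$ is subexponential, then $S$ is faithful. In particular, any $F_r$-set of maximal growth is faithful.
   Context: An $F_r$-set $S$ is faithful if for any two different $u,v\in F_r$ there is $s\in S$ such that $su\ne sv$. A function $f$ on $\mathbb{N}$ with positive values is subexponential if $\limsup_{n\to\infty}\sqrt[n]{f(n)}\le1$. Fix a free basis $X$ of $F_r$ ($r$ finite); $F(n)$ is the set of elements of reduced length at most $n$ in $X\cup X^{-1}$. For an $F_r$-set $S$ generated by a finite set $A$ (i.e. $S=AF_r$) the growth function is $g(n)=g_{A,S}(n)=\#(A\,F(n))$. Functions $f,g$ are equivalent if for some nonnegative integers $C,C'$ one has $f(n)\le g(n+C)$ and $g(n)\le f(n+C')$ for all $n\ge0$. A finitely generated $F_r$-set has maximal growth if its growth function is equivalent to that of the action of $F_r$ on itself, i.e. to $(2r-1)^n$ (independently of the finite generating set); an arbitrary $F_r$-set has maximal growth if it contains a finitely generated $F_r$-subset of maximal growth. *)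

theory Defs
  imports Complex_Main "HOL-Library.Extended_Real" "HOL-Algebra.Group"
begin

section \<open>Free groups\<close>

text \<open>
  A word over \<open>X\<close> is a list of letters \<open>(x, b)\<close>, where \<open>(x, True)\<close> stands for \<open>x\<close> and
  \<open>(x, False)\<close> for its formal inverse.  Letters are formal on purpose: if both \<open>x\<close> and
  its inverse in the group belonged to \<open>X\<close>, the group element would have two different spellings,
  so that such an \<open>X\<close> is not a free basis.
\<close>

fun letter_value :: "('a, 'm) monoid_scheme \<Rightarrow> 'a \<times> bool \<Rightarrow> 'a" where
  "letter_value F (x, b) = (if b then x else inv\<^bsub>F\<^esub> x)"

definition word_value :: "('a, 'm) monoid_scheme \<Rightarrow> ('a \<times> bool) list \<Rightarrow> 'a" where
  "word_value F w = foldr (\<lambda>l g. letter_value F l \<otimes>\<^bsub>F\<^esub> g) w \<one>\<^bsub>F\<^esub>"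

definition reduced_words :: "'a set \<Rightarrow> ('a \<times> bool) list set" where
  "reduced_words X =
    {w. fst ` set w \<subseteq> X \<and>
        successively (\<lambda>l l'. \<not> (fst l = fst l' \<and> snd l \<noteq> snd l')) w}"

text \<open>\<open>F\<close> is a free group with free basis \<open>X\<close>.\<close>

definition free_group_on :: "('a, 'm) monoid_scheme \<Rightarrow> 'a set \<Rightarrow> bool" where
  "free_group_on F X \<longleftrightarrow>
    group F \<and> X \<subseteq> carrier F \<and>
    (\<forall>g\<in>carrier F. \<exists>!w. w \<in> reduced_words X \<and> word_value F w = g)"

definition reduced_length :: "('a, 'm) monoid_scheme \<Rightarrow> 'a set \<Rightarrow> 'a \<Rightarrow> nat" where
  "reduced_length F X g = length (THE w. w \<in> reduced_words X \<and> word_value F w = g)"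

definition word_ball :: "('a, 'm) monoid_scheme \<Rightarrow> 'a set \<Rightarrow> nat \<Rightarrow> 'a set" where
  "word_ball F X n = {g \<in> carrier F. reduced_length F X g \<le> n}"


section \<open>Right group actions\<close>

definition right_gset ::
    "('a, 'm) monoid_scheme \<Rightarrow> 'b set \<Rightarrow> ('b \<Rightarrow> 'a \<Rightarrow> 'b) \<Rightarrow> bool" where
  "right_gset F S act \<longleftrightarrow>
    group F \<and>
    (\<forall>s\<in>S. \<forall>u\<in>carrier F. act s u \<in> S) \<and>
    (\<forall>s\<in>S. act s \<one>\<^bsub>F\<^esub> = s) \<and>
    (\<forall>s\<in>S. \<forall>u\<in>carrier F. \<forall>v\<in>carrier F. act (act s u) v = act s (u \<otimes>\<^bsub>F\<^esub> v))"

definition faithful_gset ::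
    "('a, 'm) monoid_scheme \<Rightarrow> 'b set \<Rightarrow> ('b \<Rightarrow> 'a \<Rightarrow> 'b) \<Rightarrow> bool" where
  "faithful_gset F S act \<longleftrightarrow>
    (\<forall>u\<in>carrier F. \<forall>v\<in>carrier F. u \<noteq> v \<longrightarrow> (\<exists>s\<in>S. act s u \<noteq> act s v))"

definition finite_generating_set ::
    "('a, 'm) monoid_scheme \<Rightarrow> 'b set \<Rightarrow> ('b \<Rightarrow> 'a \<Rightarrow> 'b) \<Rightarrow> 'b set \<Rightarrow> bool" where
  "finite_generating_set F S act A \<longleftrightarrow>
    finite A \<and> A \<subseteq> S \<and> S = {act a u | a u. a \<in> A \<and> u \<in> carrier F}"


section \<open>Growth\<close>

definition growth ::
    "('a, 'm) monoid_scheme \<Rightarrow> 'a set \<Rightarrow> ('b \<Rightarrow> 'a \<Rightarrow> 'b) \<Rightarrow> 'b set \<Rightarrow> nat \<Rightarrow> nat" where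
  "growth F X act A n = card {act a u | a u. a \<in> A \<and> u \<in> word_ball F X n}"

definition growth_equivalent :: "(nat \<Rightarrow> nat) \<Rightarrow> (nat \<Rightarrow> nat) \<Rightarrow> bool" where
  "growth_equivalent f g \<longleftrightarrow>
    (\<exists>C C'. \<forall>n. f n \<le> g (n + C) \<and> g n \<le> f (n + C'))"

text \<open>The comparison function is the growth function of \<open>F\<close> acting on itself by right
  multiplication, generated by the unit.  Up to equivalence, the growth function of \<open>S\<close> does not
  depend on the choice of \<open>A\<close>.\<close>

definition fg_maximal_growth ::
    "('a, 'm) monoid_scheme \<Rightarrow> 'a set \<Rightarrow> 'b set \<Rightarrow> ('b \<Rightarrow> 'a \<Rightarrow> 'b) \<Rightarrow> bool" where
  "fg_maximal_growth F X S act \<longleftrightarrow>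
    (\<exists>A. finite_generating_set F S act A \<and>
         growth_equivalent (growth F X act A) (growth F X (\<otimes>\<^bsub>F\<^esub>) {\<one>\<^bsub>F\<^esub>}))"

definition maximal_growth ::
    "('a, 'm) monoid_scheme \<Rightarrow> 'a set \<Rightarrow> 'b set \<Rightarrow> ('b \<Rightarrow> 'a \<Rightarrow> 'b) \<Rightarrow> bool" where
  "maximal_growth F X S act \<longleftrightarrow>
    (\<exists>T\<subseteq>S. right_gset F T act \<and> fg_maximal_growth F X T act)"

text \<open>Positivity is part of the definition; in particular it excludes the junk value
  \<open>x / 0 = 0\<close> when \<open>f\<close> is a quotient by a growth function.\<close>

definition subexponential :: "(nat \<Rightarrow> real) \<Rightarrow> bool" where
  "subexponential f \<longleftrightarrow>
    (\<forall>n. f n > 0) \<and> limsup (\<lambda>n. ereal (root n (f n))) \<le> 1"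

end

theory Submission
  imports Defs "HOL-Library.Sublist"
begin

text \<open>
  If the action is not faithful, some nontrivial \<open>g\<close> acts trivially; let \<open>w\<close> be its reduced
  spelling. Occurrences of \<open>w\<close> in a word can be deleted without changing the action, so only
  reduced words avoiding \<open>w\<close> as a factor contribute to the growth. Put \<open>q = 2r - 1\<close> and
  \<open>K = |w| + 1\<close>. As \<open>2r > 2\<close>, every nonempty reduced word \<open>p\<close> has a reduced extension \<open>p c w\<close> for
  some letter \<open>c\<close>, so at most \<open>q^K - 1\<close> of its \<open>q^K\<close> reduced extensions by \<open>K\<close> letters avoid \<open>w\<close>.
  Hence the growth is \<open>O(\<mu>^n)\<close> with \<open>\<mu>^K = q^K - 1\<close>, which is exponentially smaller than \<open>q^n\<close>.
\<close>

section \<open>Counting reduced words\<close>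

definition flip :: "'a \<times> bool \<Rightarrow> 'a \<times> bool" where
  "flip l = (fst l, \<not> snd l)"

text \<open>Each letter forbids exactly one successor, its formal inverse \<open>flip l\<close>; in
  this form the admissible successors can be counted directly.\<close>

lemma reduced_words_alt:
  "reduced_words X = {w. set w \<subseteq> X \<times> UNIV \<and> successively (\<lambda>l l'. l' \<noteq> flip l) w}"
proof -
  have "\<not> (fst l = fst l' \<and> snd l \<noteq> snd l') \<longleftrightarrow> l' \<noteq> flip l" for l l' :: "'a \<times> bool"
    by (auto simp: flip_def prod_eq_iff)
  moreover have "fst ` set w \<subseteq> X \<longleftrightarrow> set w \<subseteq> X \<times> UNIV" for w :: "('a \<times> bool) list"
    by auto
  ultimately show ?thesis
    unfolding reduced_words_def by presburger
qed

lemma finite_reduced_words_length: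
  assumes "finite X"
  shows "finite {w \<in> reduced_words X. length w = n}"
proof (rule finite_subset)
  show "{w \<in> reduced_words X. length w = n} \<subseteq> {w. set w \<subseteq> X \<times> UNIV \<and> length w = n}"
    by (auto simp: reduced_words_alt)
  show "finite {w. set w \<subseteq> X \<times> (UNIV :: bool set) \<and> length w = n}"
    using assms by (intro finite_lists_length_eq) auto
qed

lemma reduced_words_Cons_Cons:
  "l # l' # w \<in> reduced_words X \<longleftrightarrow> l \<in> X \<times> UNIV \<and> l' \<noteq> flip l \<and> l' # w \<in> reduced_words X"
  by (auto simp: reduced_words_alt)

text \<open>Reducedness only concerns adjacent letters, so it passes to factors, and the last letter
  of \<open>p\<close> is all that \<open>e\<close> has to be compatible with.\<close>

lemma reduced_words_appendD:
  assumes "p @ e \<in> reduced_words X"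
  shows "p \<in> reduced_words X" and "e \<in> reduced_words X"
    and "p \<noteq> [] \<Longrightarrow> last p # e \<in> reduced_words X"
  using assms
  by (cases e; auto simp: reduced_words_alt successively_append_iff)+

text \<open>The letter \<open>l\<close> constrains \<open>e\<close> without being part of it: these
  are the continuations by \<open>k\<close> letters of any reduced word over \<open>X\<close> that
  ends in \<open>l\<close>.\<close>

definition reduced_extensions ::
    "'a set \<Rightarrow> 'a \<times> bool \<Rightarrow> nat \<Rightarrow> ('a \<times> bool) list set" where
  "reduced_extensions X l k = {e. length e = k \<and> l # e \<in> reduced_words X}"

lemma reduced_extensions_Suc:
  assumes "l \<in> X \<times> UNIV"
  shows "reduced_extensions X l (Suc k) =
    (\<lambda>(m, e). m # e) ` (SIGMA m : X \<times> UNIV - {flip l}. reduced_extensions X m k)"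
proof (rule Set.set_eqI)
  fix e
  show "e \<in> reduced_extensions X l (Suc k) \<longleftrightarrow>
    e \<in> (\<lambda>(m, e). m # e) ` (SIGMA m : X \<times> UNIV - {flip l}. reduced_extensions X m k)"
  proof (cases e)
    case Nil
    then show ?thesis by (auto simp: reduced_extensions_def)
  next
    case (Cons m e')
    have "m # e' \<in> reduced_words X \<Longrightarrow> m \<in> X \<times> UNIV"
      by (auto simp: reduced_words_alt)
    with Cons assms show ?thesis
      by (auto simp: reduced_extensions_def reduced_words_Cons_Cons image_iff)
  qed
qed

text \<open>Of the \<open>2 * card X\<close> letters only \<open>flip l\<close> cannot follow
  \<open>l\<close>, so each further letter multiplies the count by \<open>2 * card X - 1\<close>.
  Finiteness runs through the same induction because counting the dependent sum needs finite
  fibres.\<close>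

lemma card_reduced_extensions:
  assumes "finite X" and "l \<in> X \<times> UNIV"
  shows "finite (reduced_extensions X l k) \<and>
    card (reduced_extensions X l k) = (2 * card X - 1) ^ k"
  using assms(2)
proof (induction k arbitrary: l)
  case 0
  then have "reduced_extensions X l 0 = {[]}"
    by (auto simp: reduced_extensions_def reduced_words_alt)
  then show ?case by simp
next
  case (Suc k)
  let ?M = "X \<times> (UNIV :: bool set) - {flip l}"
  have flip: "flip l \<in> X \<times> UNIV"
    using Suc.prems by (auto simp: flip_def)
  have fin: "finite ?M"
    using assms(1) by simp
  have "card ?M = 2 * card X - 1"
    using flip assms(1) by (subst card_Diff_singleton) (auto simp: card_cartesian_product)
  moreover have "inj_on (\<lambda>(m, e). m # e) (SIGMA m : ?M. reduced_extensions X m k)"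
    by (auto simp: inj_on_def)
  ultimately show ?case
    using Suc fin
    by (auto simp: reduced_extensions_Suc card_image card_SigmaI)
qed

section \<open>Words avoiding a factor\<close>

definition avoiding_words :: "'a set \<Rightarrow> ('a \<times> bool) list \<Rightarrow> nat \<Rightarrow> ('a \<times> bool) list set" where
  "avoiding_words X w n = {p \<in> reduced_words X. length p = n \<and> \<not> sublist w p}"

lemma finite_avoiding_words:
  "finite X \<Longrightarrow> finite (avoiding_words X w n)"
  using finite_reduced_words_length[of X n]
  by (rule finite_subset[rotated]) (auto simp: avoiding_words_def)

text \<open>A letter \<open>c\<close> fits between \<open>l\<close> and \<open>w\<close> unless it
  is \<open>flip l\<close> or \<open>flip (hd w)\<close>. Two generators already give four letters,
  so one is left.\<close>

lemma ex_connecting_letter: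
  assumes "finite X" and "card X > 1" and "w \<in> reduced_words X" and "w \<noteq> []"
    and "l \<in> X \<times> UNIV"
  obtains c where "c # w \<in> reduced_extensions X l (Suc (length w))"
proof -
  have "card {flip l, flip (hd w)} \<le> 2"
    by (simp add: card_insert_if)
  also have "2 < card (X \<times> (UNIV :: bool set))"
    using assms by (simp add: card_cartesian_product)
  finally have "\<not> X \<times> UNIV \<subseteq> {flip l, flip (hd w)}"
    by (metis card_mono finite.emptyI finite.insertI leD)
  then obtain c where c: "c \<in> X \<times> UNIV" "c \<noteq> flip l" "c \<noteq> flip (hd w)"
    by blast
  then have "hd w \<noteq> flip c"
    by (auto simp: flip_def)
  then have "c # w \<in> reduced_extensions X l (Suc (length w))"
    using assms c by (cases w) (auto simp: reduced_extensions_def reduced_words_Cons_Cons)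
  then show ?thesis by (rule that)
qed

text \<open>Cut the word after \<open>m\<close> letters: the prefix avoids \<open>w\<close>, and so
  does the rest, which is a reduced extension of the prefix's last letter (it exists as
  \<open>m \<ge> 1\<close>). For every prefix at least one extension is lost, namely
  \<open>c # w\<close> with a connecting letter \<open>c\<close>; its length is the reason for the
  choice of \<open>K\<close>.\<close>

lemma card_avoiding_words_step:
  assumes "finite X" and "card X > 1" and "w \<in> reduced_words X" and "w \<noteq> []" and "m \<ge> 1"
  defines "K \<equiv> Suc (length w)"
  shows "card (avoiding_words X w (m + K)) \<le>
    ((2 * card X - 1) ^ K - 1) * card (avoiding_words X w m)"
proof -
  \<comment> \<open>Occurrences of \<open>w\<close> across the cut are tolerated here, since only an
    upper bound is wanted.\<close>
  define E where
    "E p = {e \<in> reduced_extensions X (last p) K. \<not> sublist w e}" for p :: "('a \<times> bool) list"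
  have E: "finite (E p) \<and> card (E p) \<le> (2 * card X - 1) ^ K - 1"
    if "p \<in> avoiding_words X w m" for p
  proof -
    have "p \<noteq> []" "set p \<subseteq> X \<times> UNIV"
      using that \<open>m \<ge> 1\<close> by (auto simp: avoiding_words_def reduced_words_alt)
    then have l: "last p \<in> X \<times> UNIV"
      using last_in_set by blast
    obtain c where c: "c # w \<in> reduced_extensions X (last p) K"
      using ex_connecting_letter[OF assms(1-4) l] unfolding K_def by blast
    have "E p \<subseteq> reduced_extensions X (last p) K - {c # w}"
      by (auto simp: E_def sublist_Cons_right)
    with card_reduced_extensions[OF assms(1) l, of K] c show ?thesis
      by (metis card_Diff_singleton card_mono finite_Diff finite_subset)
  qed
  have sub: "avoiding_words X w (m + K) \<subseteq> (\<lambda>(p, e). p @ e) ` (SIGMA p : avoiding_words X w m. E p)"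
  proof
    fix z assume z: "z \<in> avoiding_words X w (m + K)"
    define p e where "p = take m z" and "e = drop m z"
    have split: "z = p @ e" "length p = m" "length e = K"
      using z by (auto simp: p_def e_def avoiding_words_def)
    then have "p \<noteq> []"
      using \<open>m \<ge> 1\<close> by auto
    have red: "p @ e \<in> reduced_words X" and av: "\<not> sublist w (p @ e)"
      using z split(1) by (auto simp: avoiding_words_def)
    have "\<not> sublist w p" "\<not> sublist w e"
      using av by (auto simp: sublist_append)
    then have "p \<in> avoiding_words X w m" "e \<in> E p"
      using reduced_words_appendD[OF red] split(2,3) \<open>p \<noteq> []\<close>
      by (auto simp: avoiding_words_def E_def reduced_extensions_def)
    with split(1) show "z \<in> (\<lambda>(p, e). p @ e) ` (SIGMA p : avoiding_words X w m. E p)"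
      by force
  qed
  have fin: "finite (avoiding_words X w m)"
    using assms(1) by (rule finite_avoiding_words)
  have finS: "finite (SIGMA p : avoiding_words X w m. E p)"
    using fin E by auto
  have "card (avoiding_words X w (m + K)) \<le> card (SIGMA p : avoiding_words X w m. E p)"
    using sub finS by (rule surj_card_le[rotated])
  also have "\<dots> = (\<Sum>p\<in>avoiding_words X w m. card (E p))"
    using fin E by (intro card_SigmaI) auto
  also have "\<dots> \<le> (\<Sum>p\<in>avoiding_words X w m. (2 * card X - 1) ^ K - 1)"
    using E by (intro sum_mono) auto
  finally show ?thesis by (simp add: mult.commute)
qed

text \<open>Going down in steps of \<open>K\<close> reduces every index to an initial segment, whose
  finitely many values are absorbed by the constant.\<close>

lemma geometric_bound_of_step:
  fixes a :: "nat \<Rightarrow> real" and \<mu> :: real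
  assumes "K > 0" and "\<mu> \<ge> 1" and nonneg: "\<And>m. a m \<ge> 0"
    and step: "\<And>m. m \<ge> 1 \<Longrightarrow> a (m + K) \<le> \<mu> ^ K * a m"
  obtains C where "C \<ge> 0" and "\<And>m. a m \<le> C * \<mu> ^ m"
proof -
  \<comment> \<open>The sum dominates each of its terms, and \<open>\<mu> \<ge> 1\<close> keeps the
    bound valid there. Index \<open>K\<close> is included so that for larger \<open>m\<close> the
    index \<open>m - K\<close> is at least 1, as the recursion demands.\<close>
  define C where "C = (\<Sum>i\<le>K. a i)"
  have C: "C \<ge> 0"
    unfolding C_def by (intro sum_nonneg nonneg)
  have "a m \<le> C * \<mu> ^ m" for m
  proof (induction m rule: less_induct)
    case (less m)
    show ?case
    proof (cases "m \<le> K")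
      case True
      then have "a m \<le> C"
        unfolding C_def by (intro member_le_sum nonneg) auto
      also have "\<dots> \<le> C * \<mu> ^ m"
        using C \<open>\<mu> \<ge> 1\<close> by (simp add: mult_le_cancel_left1)
      finally show ?thesis .
    next
      case False
      then have "a m \<le> \<mu> ^ K * a (m - K)"
        using step[of "m - K"] by simp
      also have "\<dots> \<le> \<mu> ^ K * (C * \<mu> ^ (m - K))"
        using less[of "m - K"] False \<open>K > 0\<close> \<open>\<mu> \<ge> 1\<close> by (intro mult_left_mono) auto
      also have "\<dots> = C * \<mu> ^ m"
        using False by (simp flip: power_add)
      finally show ?thesis .
    qed
  qed
  with C show ?thesis by (rule that)
qed

text \<open>Growth counts balls, so the bound for exact lengths is summed; as
  \<open>\<mu> > 1\<close>, the geometric sum costs only a constant factor.\<close>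

lemma card_avoiding_words_upto:
  assumes "finite X" and "card X > 1" and "w \<in> reduced_words X" and "w \<noteq> []"
  obtains C \<mu> :: real where "C \<ge> 0" and "0 < \<mu>" and "\<mu> < 2 * real (card X) - 1"
    and "\<And>n. real (card (\<Union>m\<le>n. avoiding_words X w m)) \<le> C * \<mu> ^ n"
proof -
  define K where "K = Suc (length w)"
  define q where "q = 2 * card X - 1"
  have q: "q \<ge> 3" "real q = 2 * real (card X) - 1"
    using assms(2) by (auto simp: q_def)
  \<comment> \<open>The rate per letter that corresponds to losing one of \<open>q ^ K\<close>
    extensions in every block of \<open>K\<close> letters.\<close>
  define \<mu> where "\<mu> = root K (real q ^ K - 1)"
  have "K > 0" by (simp add: K_def)
  \<comment> \<open>\<open>q \<ge> 3\<close> keeps \<open>q ^ K - 1\<close> above 1, hence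
    \<open>\<mu> > 1\<close>, which the division by \<open>\<mu> - 1\<close> below relies
    on.\<close>
  have "(3 :: real) ^ 1 \<le> 3 ^ K"
    using \<open>K > 0\<close> by (intro power_increasing) auto
  also have "\<dots> \<le> real q ^ K"
    using q(1) by (intro power_mono) auto
  finally have qK: "real q ^ K - 1 > 1" by simp
  then have \<mu>1: "\<mu> > 1"
    using \<open>K > 0\<close> by (simp add: \<mu>_def)
  have \<mu>K: "\<mu> ^ K = real q ^ K - 1"
    using \<open>K > 0\<close> qK by (simp add: \<mu>_def)
  then have "\<mu> ^ K < real q ^ K" by simp
  then have \<mu>q: "\<mu> < real q"
    by (rule power_less_imp_less_base) simp
  have step: "real (card (avoiding_words X w (m + K))) \<le>
      \<mu> ^ K * real (card (avoiding_words X w m))" if "m \<ge> 1" for m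
  proof -
    have "real (card (avoiding_words X w (m + K))) \<le>
      real ((q ^ K - 1) * card (avoiding_words X w m))"
      using card_avoiding_words_step[OF assms that] unfolding K_def q_def
      by (rule of_nat_mono)
    also have "\<dots> = \<mu> ^ K * real (card (avoiding_words X w m))"
      using q(1) by (simp add: \<mu>K of_nat_diff)
    finally show ?thesis .
  qed
  obtain C where C: "C \<ge> 0" "\<And>m. real (card (avoiding_words X w m)) \<le> C * \<mu> ^ m"
    using geometric_bound_of_step[of K \<mu> "\<lambda>m. real (card (avoiding_words X w m))"]
      \<open>K > 0\<close> \<mu>1 step by auto
  have "real (card (\<Union>m\<le>n. avoiding_words X w m)) \<le> C * \<mu> / (\<mu> - 1) * \<mu> ^ n" for n
  proof -
    have "real (card (\<Union>m\<le>n. avoiding_words X w m)) \<le> real (\<Sum>m\<le>n. card (avoiding_words X w m))"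
      by (intro of_nat_mono card_UN_le) auto
    also have "\<dots> \<le> (\<Sum>m\<le>n. C * \<mu> ^ m)"
      by (simp add: C(2) sum_mono)
    also have "\<dots> = C * (\<Sum>m<Suc n. \<mu> ^ m)"
      by (simp only: sum_distrib_left lessThan_Suc_atMost)
    also have "\<dots> = C * ((\<mu> ^ Suc n - 1) / (\<mu> - 1))"
      using \<mu>1 by (subst geometric_sum) auto
    also have "\<dots> \<le> C * (\<mu> ^ Suc n / (\<mu> - 1))"
      using C(1) \<mu>1 by (intro mult_left_mono divide_right_mono) auto
    finally show ?thesis by simp
  qed
  moreover have "C * \<mu> / (\<mu> - 1) \<ge> 0"
    using C(1) \<mu>1 by simp
  ultimately show ?thesis
    using that \<mu>1 \<mu>q q(2) by (metis less_trans zero_less_one)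
qed

section \<open>Values of words\<close>

context group
begin

lemma letter_value_closed:
  "X \<subseteq> carrier G \<Longrightarrow> l \<in> X \<times> UNIV \<Longrightarrow> letter_value G l \<in> carrier G"
  by (cases l) auto

lemma word_value_closed:
  assumes "X \<subseteq> carrier G" and "set p \<subseteq> X \<times> UNIV"
  shows "word_value G p \<in> carrier G"
  using assms(2)
  by (induction p) (auto simp: word_value_def simp del: letter_value.simps
      intro!: m_closed letter_value_closed[OF assms(1)])

lemma word_value_append:
  assumes "X \<subseteq> carrier G" and "set p \<subseteq> X \<times> UNIV" and "set p' \<subseteq> X \<times> UNIV"
  shows "word_value G (p @ p') = word_value G p \<otimes> word_value G p'"
  using assms(2)
proof (induction p)
  case Nil
  then show ?case
    using word_value_closed[OF assms(1,3)] by (simp add: word_value_def)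
next
  case (Cons l p)
  have "word_value G (l # z) = letter_value G l \<otimes> word_value G z" for z
    by (simp add: word_value_def)
  with Cons show ?case
    using word_value_closed[OF assms(1,3)] word_value_closed[OF assms(1), of p]
      letter_value_closed[OF assms(1), of l]
    by (simp add: m_assoc)
qed

lemma word_value_cancel:
  assumes "X \<subseteq> carrier G" and "l \<in> X \<times> UNIV"
  shows "word_value G [l, flip l] = \<one>"
  using assms by (cases l) (auto simp: word_value_def flip_def)

end

text \<open>Locates a cancelling pair in a word that is not reduced.\<close>

lemma not_successivelyE:
  assumes "\<not> successively P p"
  obtains x l l' y where "p = x @ [l, l'] @ y" and "\<not> P l l'"
proof -
  have "\<exists>x l l' y. p = x @ [l, l'] @ y \<and> \<not> P l l'"
    using assms
  proof (induction p rule: induct_list012)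
    case (3 l l' p)
    show ?case
    proof (cases "P l l'")
      case True
      then obtain x k k' y where "l' # p = x @ [k, k'] @ y" "\<not> P k k'"
        using 3 by auto
      then have "l # l' # p = (l # x) @ [k, k'] @ y" "\<not> P k k'"
        by auto
      then show ?thesis by blast
    next
      case False
      then show ?thesis
        by (metis append_Cons append_Nil)
    qed
  qed auto
  with that show ?thesis by blast
qed

section \<open>Growth of unfaithful actions\<close>

text \<open>Occurrences of \<open>w\<close> and cancelling pairs both act trivially and may be
  deleted. Either deletion can create new instances of the other kind, so one induction on the
  length treats both.\<close>

lemma act_avoiding_word:
  assumes act: "right_gset F S act" and X: "X \<subseteq> carrier F"
    and w: "set w \<subseteq> X \<times> UNIV" "w \<noteq> []"
    and triv: "\<And>s. s \<in> S \<Longrightarrow> act s (word_value F w) = s"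
    and s: "s \<in> S" and p: "set p \<subseteq> X \<times> UNIV"
  obtains p' where "length p' \<le> length p" and "p' \<in> avoiding_words X w (length p')"
    and "act s (word_value F p') = act s (word_value F p)"
  using p
proof (induction p arbitrary: thesis rule: length_induct)
  case (1 p)
  interpret group F
    using act by (simp add: right_gset_def)
  note closed = word_value_closed[OF X]
  have act_append: "act s' (word_value F (x @ y)) = act (act s' (word_value F x)) (word_value F y)"
    if "s' \<in> S" "set x \<subseteq> X \<times> UNIV" "set y \<subseteq> X \<times> UNIV" for s' x y
    using act that closed[of x] closed[of y] word_value_append[OF X, of x y]
    by (simp add: right_gset_def)
  have act_in: "act s' (word_value F x) \<in> S"
    if "s' \<in> S" "set x \<subseteq> X \<times> UNIV" for s' x
    using act that closed[of x] by (simp add: right_gset_def)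
  \<comment> \<open>The factor \<open>z\<close> acts on the point reached after \<open>x\<close>,
    not on \<open>s\<close> itself, so it must fix every point of \<open>S\<close>.\<close>
  have delete: thesis
    if z: "p = x @ z @ y" "z \<noteq> []" and tz: "\<And>s. s \<in> S \<Longrightarrow> act s (word_value F z) = s" for x y z
  proof -
    have xy: "set x \<subseteq> X \<times> UNIV" "set y \<subseteq> X \<times> UNIV" "set z \<subseteq> X \<times> UNIV"
      using z "1.prems"(2) by auto
    have eq: "act s (word_value F (x @ y)) = act s (word_value F p)"
      using z(1) s xy tz act_append act_in by simp
    have "length (x @ y) < length p" "set (x @ y) \<subseteq> X \<times> UNIV"
      using z xy by auto
    with "1.IH" obtain p' where "length p' \<le> length (x @ y)"
      "p' \<in> avoiding_words X w (length p')" "act s (word_value F p') = act s (word_value F (x @ y))"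
      by blast
    with eq z(1) show thesis
      by (intro "1.prems"(1)[of p']) auto
  qed
  consider "sublist w p" | "\<not> successively (\<lambda>l l'. l' \<noteq> flip l) p"
    | "p \<in> avoiding_words X w (length p)"
    using "1.prems"(2) by (auto simp: avoiding_words_def reduced_words_alt)
  then show ?case
  proof cases
    case 1
    then obtain x y where "p = x @ w @ y"
      by (auto simp: sublist_def)
    then show ?thesis
      using w(2) triv by (rule delete)
  next
    case 2
    then obtain x l y where p: "p = x @ [l, flip l] @ y"
      using not_successivelyE[OF 2] by metis
    have "l \<in> X \<times> UNIV"
      using "1.prems"(2) p by auto
    then have "word_value F [l, flip l] = \<one>\<^bsub>F\<^esub>"
      using X by (intro word_value_cancel)
    then have "act s (word_value F [l, flip l]) = s" if "s \<in> S" for s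
      using that act by (simp add: right_gset_def)
    then show ?thesis
      using delete[OF p] by blast
  next
    case 3
    then show ?thesis
      using "1.prems"(1) by blast
  qed
qed

lemma free_group_on_word:
  assumes "free_group_on F X" and "g \<in> carrier F"
  obtains w where "w \<in> reduced_words X" and "word_value F w = g"
    and "length w = reduced_length F X g"
proof -
  have "\<exists>!w. w \<in> reduced_words X \<and> word_value F w = g"
    using assms by (simp add: free_group_on_def)
  from theI'[OF this] show ?thesis
    by (intro that) (auto simp: reduced_length_def)
qed

text \<open>If \<open>u\<close> and \<open>v\<close> act alike, their quotient acts trivially and
  its reduced spelling \<open>w\<close> can be deleted everywhere. The points counted by the growth
  are then reached from \<open>A\<close> by words avoiding \<open>w\<close>, which gives
  \<open>D\<close> as \<open>card A\<close> times the constant for such words.\<close>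

lemma growth_le_of_not_faithful:
  assumes free: "free_group_on F X" and X: "finite X" "card X > 1"
    and act: "right_gset F S act" and A: "finite A" "A \<subseteq> S"
    and unfaithful: "\<not> faithful_gset F S act"
  obtains D \<mu> :: real where "0 < \<mu>" and "\<mu> < 2 * real (card X) - 1"
    and "\<And>n. real (growth F X act A n) \<le> D * \<mu> ^ n"
proof -
  interpret group F
    using act by (simp add: right_gset_def)
  have XF: "X \<subseteq> carrier F"
    using free by (simp add: free_group_on_def)
  obtain u v where uv: "u \<in> carrier F" "v \<in> carrier F" "u \<noteq> v"
    and same: "\<And>s. s \<in> S \<Longrightarrow> act s u = act s v"
    using unfaithful unfolding faithful_gset_def by blast
  let ?g = "u \<otimes>\<^bsub>F\<^esub> inv\<^bsub>F\<^esub> v"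
  have triv: "act s ?g = s" if "s \<in> S" for s
  proof -
    have "act s ?g = act (act s u) (inv\<^bsub>F\<^esub> v)"
      using act uv that by (simp add: right_gset_def)
    also have "\<dots> = act (act s v) (inv\<^bsub>F\<^esub> v)"
      using same that by simp
    also have "\<dots> = act s (v \<otimes>\<^bsub>F\<^esub> inv\<^bsub>F\<^esub> v)"
      using act uv that inv_closed[OF uv(2)] unfolding right_gset_def by blast
    finally show ?thesis
      using act uv that by (simp add: right_gset_def)
  qed
  have "?g \<noteq> \<one>\<^bsub>F\<^esub>"
    using uv by (metis inv_closed inv_equality inv_inv)
  obtain w where w: "w \<in> reduced_words X" "word_value F w = ?g"
    using free_group_on_word[OF free] uv by (metis inv_closed m_closed)
  have "w \<noteq> []"
    using w(2) \<open>?g \<noteq> \<one>\<^bsub>F\<^esub>\<close> by (auto simp: word_value_def)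
  have wX: "set w \<subseteq> X \<times> UNIV"
    using w(1) by (auto simp: reduced_words_alt)
  obtain C \<mu> :: real where \<mu>: "0 < \<mu>" "\<mu> < 2 * real (card X) - 1"
    and C: "\<And>n. real (card (\<Union>m\<le>n. avoiding_words X w m)) \<le> C * \<mu> ^ n"
    using card_avoiding_words_upto[OF X w(1) \<open>w \<noteq> []\<close>] by metis
  have "real (growth F X act A n) \<le> (real (card A) * C) * \<mu> ^ n" for n
  proof -
    let ?W = "\<Union>m\<le>n. avoiding_words X w m"
    have fin: "finite (A \<times> ?W)"
      using A(1) X(1) by (auto intro: finite_avoiding_words)
    have "{act a g | a g. a \<in> A \<and> g \<in> word_ball F X n} \<subseteq>
      (\<lambda>(a, p). act a (word_value F p)) ` (A \<times> ?W)"
    \<comment> \<open>The shortened word starts from the same \<open>a\<close> and is no longer than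
      the reduced spelling of \<open>g\<close>, so it stays within length \<open>n\<close>.\<close>
    proof clarify
      fix a g assume a: "a \<in> A" and g: "g \<in> word_ball F X n"
      then obtain p where p: "p \<in> reduced_words X" "word_value F p = g" "length p \<le> n"
        by (metis (no_types, lifting) free free_group_on_word mem_Collect_eq word_ball_def)
      then have "set p \<subseteq> X \<times> UNIV"
        by (auto simp: reduced_words_alt)
      moreover have "act s (word_value F w) = s" if "s \<in> S" for s
        using triv[OF that] w(2) by simp
      moreover have "a \<in> S"
        using a A(2) by blast
      ultimately obtain p' where "length p' \<le> length p" "p' \<in> avoiding_words X w (length p')"
        "act a (word_value F p') = act a (word_value F p)"
        using act_avoiding_word[OF act XF wX \<open>w \<noteq> []\<close>] by metis
      with p a show "act a g \<in> (\<lambda>(a, p). act a (word_value F p)) ` (A \<times> ?W)"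
        by (intro image_eqI[of _ _ "(a, p')"]) auto
    qed
    then have "growth F X act A n \<le> card (A \<times> ?W)"
      unfolding growth_def using fin by (rule surj_card_le[rotated])
    then have "real (growth F X act A n) \<le> real (card A) * real (card ?W)"
      by (simp add: card_cartesian_product flip: of_nat_mult)
    also have "\<dots> \<le> real (card A) * (C * \<mu> ^ n)"
      using C[of n] by (intro mult_left_mono) auto
    finally show ?thesis by simp
  qed
  with \<mu> show ?thesis by (rule that)
qed

section \<open>Lower bound for the growth of the free group\<close>

lemma growth_self_ge:
  assumes free: "free_group_on F X" and X: "finite X" "X \<noteq> {}"
  shows "(2 * card X - 1) ^ n \<le> growth F X (\<otimes>\<^bsub>F\<^esub>) {\<one>\<^bsub>F\<^esub>} n"
proof -
  interpret group F
    using free by (simp add: free_group_on_def)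
  have XF: "X \<subseteq> carrier F"
    using free by (simp add: free_group_on_def)
  have unique: "\<exists>!w. w \<in> reduced_words X \<and> word_value F w = g" if "g \<in> carrier F" for g
    using free that by (simp add: free_group_on_def)
  have closed: "word_value F p \<in> carrier F" if "p \<in> reduced_words X" for p
    using that by (intro word_value_closed[OF XF]) (auto simp: reduced_words_alt)
  have length: "reduced_length F X (word_value F p) = length p" if "p \<in> reduced_words X" for p
    using that unique[OF closed[OF that]] unfolding reduced_length_def
    by (metis (mono_tags, lifting) the1_equality)
  obtain x where "x \<in> X"
    using X(2) by blast
  \<comment> \<open>Reduced words of length \<open>n + 1\<close> starting with a fixed letter,
    stripped of it, are reduced words of length \<open>n\<close>; this subfamily of the sphere has
    exactly the cardinality wanted.\<close>
  define l where "l = (x, True)"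
  have l: "l \<in> X \<times> UNIV"
    using \<open>x \<in> X\<close> by (simp add: l_def)
  have ext: "e \<in> reduced_words X" if "e \<in> reduced_extensions X l n" for e
    using that reduced_words_appendD(2)[of "[l]" e X] by (simp add: reduced_extensions_def)
  have inj: "inj_on (word_value F) (reduced_extensions X l n)"
    using ext closed unique by (intro inj_onI) metis
  have sub: "word_value F ` reduced_extensions X l n \<subseteq> word_ball F X n"
    using ext closed length by (auto simp: word_ball_def reduced_extensions_def)
  \<comment> \<open>Gives finiteness of the ball; an infinite set would have \<open>card\<close>
    equal to 0.\<close>
  have "word_ball F X n \<subseteq> word_value F ` (\<Union>m\<le>n. {p \<in> reduced_words X. length p = m})"
  proof
    fix g assume g: "g \<in> word_ball F X n"
    then have "g \<in> carrier F" "reduced_length F X g \<le> n"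
      by (auto simp: word_ball_def)
    with free_group_on_word[OF free] obtain p
      where "p \<in> reduced_words X" "word_value F p = g" "length p \<le> n"
      by metis
    then show "g \<in> word_value F ` (\<Union>m\<le>n. {p \<in> reduced_words X. length p = m})"
      by auto
  qed
  then have fin: "finite (word_ball F X n)"
    by (rule finite_subset) (auto intro: finite_reduced_words_length X(1))
  have "(2 * card X - 1) ^ n = card (word_value F ` reduced_extensions X l n)"
    using card_reduced_extensions[OF X(1) l, of n] inj by (simp add: card_image)
  also have "\<dots> \<le> card (word_ball F X n)"
    using fin sub by (rule card_mono)
  also have "word_ball F X n = {a \<otimes>\<^bsub>F\<^esub> u | a u. a \<in> {\<one>\<^bsub>F\<^esub>} \<and> u \<in> word_ball F X n}"
    by (force simp: word_ball_def)
  finally show ?thesis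
    by (simp add: growth_def)
qed

section \<open>Comparison of exponential rates\<close>

lemma not_subexponential_quotient:
  fixes q \<mu> D :: real and g :: "nat \<Rightarrow> real"
  assumes \<mu>: "0 < \<mu>" "\<mu> < q" and g: "\<And>n. g n \<le> D * \<mu> ^ n"
  shows "\<not> subexponential (\<lambda>n. q ^ n / g n)"
proof
  assume sub: "subexponential (\<lambda>n. q ^ n / g n)"
  have q: "q > 0" using \<mu> by simp
  \<comment> \<open>Positivity of the quotient rules out \<open>g n = 0\<close> as well, because
    \<open>x / 0 = 0\<close>.\<close>
  have gpos: "g n > 0" for n
    using sub q by (auto simp: subexponential_def zero_less_divide_iff dest: spec[of _ n])
  have D: "D > 0"
    using gpos[of 0] g[of 0] by simp
  have "(\<lambda>n. root n D) \<longlonglongrightarrow> 1"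
    using D by (rule LIMSEQ_root_const)
  then have "(\<lambda>n. ereal (q / \<mu> / root n D)) \<longlonglongrightarrow> ereal (q / \<mu> / 1)"
    by (intro tendsto_intros) auto
  then have "ereal (q / \<mu>) = limsup (\<lambda>n. ereal (q / \<mu> / root n D))"
    by (intro lim_imp_Limsup[symmetric]) simp_all
  also have "\<dots> \<le> limsup (\<lambda>n. ereal (root n (q ^ n / g n)))"
  \<comment> \<open>The \<open>n\<close>-th root turns the lower bound
    \<open>q ^ n / (D * \<mu> ^ n)\<close> into a sequence tending to \<open>q / \<mu> > 1\<close>.
    It starts at 1 because \<open>root 0\<close> is the constant 0.\<close>
  proof (rule Limsup_mono, rule eventually_sequentiallyI[of 1])
    fix n :: nat assume "n \<ge> 1"
    then have "q / \<mu> / root n D = root n (q ^ n / (D * \<mu> ^ n))"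
      using q \<mu> D by (simp add: real_root_divide real_root_mult real_root_power_cancel)
    also have "\<dots> \<le> root n (q ^ n / g n)"
      using \<open>n \<ge> 1\<close> q g[of n] gpos[of n] by (simp add: divide_left_mono)
    finally show "ereal (q / \<mu> / root n D) \<le> ereal (root n (q ^ n / g n))"
      by simp
  qed
  also have "\<dots> \<le> 1"
    using sub by (simp add: subexponential_def)
  finally show False
    using \<mu> by simp
qed

text \<open>The shift by \<open>C\<close> only multiplies by the constant \<open>\<mu> ^ C\<close>,
  which the powers of \<open>q / \<mu> > 1\<close> eventually exceed.\<close>

lemma shifted_smaller_exponential_less:
  fixes q \<mu> D :: real
  assumes "0 < \<mu>" "\<mu> < q"
  obtains n where "D * \<mu> ^ (n + C) < q ^ n"
proof -
  obtain n where "D * \<mu> ^ C < (q / \<mu>) ^ n"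
    using assms real_arch_pow[of "q / \<mu>"] by auto
  then have "D * \<mu> ^ (n + C) < q ^ n"
    using assms by (simp add: power_divide field_simps power_add)
  then show ?thesis by (rule that)
qed

theorem proposition7:
  fixes F :: "('a, 'm) monoid_scheme"
    and X :: "'a set"
    and r :: nat
    and S :: "'b set"
    and act :: "'b \<Rightarrow> 'a \<Rightarrow> 'b"
  assumes "free_group_on F X"
    and "finite X" and "card X = r" and "r > 1"
    and "right_gset F S act"
  shows "(\<forall>A. finite_generating_set F S act A \<longrightarrow>
            subexponential (\<lambda>n. (2 * real r - 1) ^ n / real (growth F X act A n)) \<longrightarrow>
            faithful_gset F S act)
         \<and> (maximal_growth F X S act \<longrightarrow> faithful_gset F S act)"
proof (intro conjI allI impI)
  have card: "card X > 1"
    using assms(3,4) by simp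
  {
    fix A
    assume A: "finite_generating_set F S act A"
      and sub: "subexponential (\<lambda>n. (2 * real r - 1) ^ n / real (growth F X act A n))"
    show "faithful_gset F S act"
    proof (rule ccontr)
      assume "\<not> faithful_gset F S act"
      then obtain D \<mu> :: real where "0 < \<mu>" "\<mu> < 2 * real r - 1"
        "\<And>n. real (growth F X act A n) \<le> D * \<mu> ^ n"
        using growth_le_of_not_faithful[OF assms(1,2) card assms(5), of A] A assms(3)
        unfolding finite_generating_set_def by metis
      from not_subexponential_quotient[OF this] sub show False
        by contradiction
    qed
  }
  assume "maximal_growth F X S act"
  then obtain T A C where T: "T \<subseteq> S" "right_gset F T act" "finite_generating_set F T act A"
    and C: "\<And>n. growth F X (\<otimes>\<^bsub>F\<^esub>) {\<one>\<^bsub>F\<^esub>} n \<le> growth F X act A (n + C)"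
    unfolding maximal_growth_def fg_maximal_growth_def growth_equivalent_def by metis
  \<comment> \<open>The growth argument is applied to \<open>T\<close>, which carries the finite
    generating set; a point of \<open>T\<close> separating two group elements also lies in
    \<open>S\<close>.\<close>
  have "faithful_gset F T act"
  proof (rule ccontr)
    assume "\<not> faithful_gset F T act"
    then obtain D \<mu> :: real where D: "0 < \<mu>" "\<mu> < 2 * real r - 1"
      "\<And>n. real (growth F X act A n) \<le> D * \<mu> ^ n"
      using growth_le_of_not_faithful[OF assms(1,2) card T(2), of A] T(3) assms(3)
      unfolding finite_generating_set_def by metis
    from D(1,2) obtain n where n: "D * \<mu> ^ (n + C) < (2 * real r - 1) ^ n"
      by (rule shifted_smaller_exponential_less)
    have "X \<noteq> {}"
      using card by auto
    then have "(2 * r - 1) ^ n \<le> growth F X act A (n + C)"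
      using growth_self_ge[OF assms(1,2), of n] C[of n] assms(3) by simp
    then have "real ((2 * r - 1) ^ n) \<le> real (growth F X act A (n + C))"
      by (rule of_nat_mono)
    \<comment> \<open>\<open>r > 1\<close> makes the truncated \<open>2 * r - 1\<close> agree with
      the real one.\<close>
    with n D(3)[of "n + C"] \<open>r > 1\<close> show False
      by (simp add: of_nat_diff)
  qed
  with T(1) show "faithful_gset F S act"
    unfolding faithful_gset_def by blast
qed

end
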